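(* Let $F\in\mathcal F_1(I)$ be strictly decreasing and let $k\ge1$ be an odd integer. Then every decreasing iterative root $f\in\mathcal F(I)$ of order $k$ of $F$ on $I\setminus J(F)$ (i.e. strictly decreasing $f\in\mathcal F(I)$ with $f^k(x)=F(x)$ for all $x\in I\setminus J(F)$) is, on $I\setminus J(F)$, an extension of a strictly decreasing iterative root of order $k$ of $F$ on the subintervals in $\Lambda(F^2)$; that is, with $D:=\bigcup_{J\in\Lambda(F^2)}J$, one has $f(D)\subset D$, and $f|_D$ is a strictly decreasing single-valued self-map of $D$ with $(f|_D)^k=F|_D$.
   Context: Let $I=[a,b]\subset\mathbb R$, $a<b$. A multifunction $F:I\to 2^I$ assigns to each $x\in I$ a nonempty subset $F(x)\subset I$ (singletons are identified with their elements); $F(A)=\bigcup_{x\in A}F(x)$, $(G\circ F)(x)=G(F(x))$, $F^0(x)=\{x\}$, $F^n=F\circ F^{n-1}$. $F$ is upper semi-continuous (usc) at $x_0\in I$ if for every open $V\subset\mathbb R$ with $F(x_0)\subset V$ there is a neighborhood $U$ of $x_0$ such that $F(x)\subset V$ for all $x\in U\cap I$; usc means usc at every point. $F$ is strictly increasing (resp. strictly decreasing) if $\max F(x)<\min F(y)$ (resp. $\min F(x)>\max F(y)$) whenever $x,y\in I$, $x<y$; strictly monotone means one of these. $\mathcal F(I)$ is the class of strictly monotone usc multifunctions $I\to 2^I$. A jump of $F$ is a point $x_0\in I$ with $\#F(x_0)\ge 2$; $J(F)$ is the set of jumps. For $F\in\mathcal F(I)$ with finitely many jumps, the intensity $\zeta(F)$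 is the least integer $k\ge 0$ with $\#J(F^k)=\#J(F^{k+1})$ (and $+\infty$ if there is none). $\mathcal F_1(I)$ is the set of $F\in\mathcal F(I)$ with finitely many jumps and $\zeta(F)=1$. For $F\in\mathcal F_1(I)$ write $J(F)=\{c_1,\dots,c_m\}$ with the standing convention $a=:c_0<c_1<\dots<c_m<c_{m+1}:=b$, put $I_i:=(c_i,c_{i+1})$ and $I(F):=\{I_i: i=0,\dots,m\}$. If $F\in\mathcal F_1(I)$ is strictly decreasing, then $F^2\in\mathcal F_1(I)$ is strictly increasing and $I(F^2)=I(F)$; $\Lambda(F^2)$ is the set of all $J\in I(F^2)$ with $F^2(J)\subset J$. *)

theory Defs
  imports Complex_Main "HOL-Library.Extended_Nat"
begin

text \<open>
  A multifunction on \<open>I = {a..b}\<close> is a function of type \<open>real \<Rightarrow> real set\<close>; its values outside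
  \<open>{a..b}\<close> are irrelevant to every notion below.
\<close>

definition multifun :: "real \<Rightarrow> real \<Rightarrow> (real \<Rightarrow> real set) \<Rightarrow> bool" where
  "multifun a b F \<longleftrightarrow> (\<forall>x\<in>{a..b}. F x \<noteq> {} \<and> F x \<subseteq> {a..b})"

definition mimage :: "(real \<Rightarrow> real set) \<Rightarrow> real set \<Rightarrow> real set" where
  "mimage F A = (\<Union>x\<in>A. F x)"

definition mcomp :: "(real \<Rightarrow> real set) \<Rightarrow> (real \<Rightarrow> real set) \<Rightarrow> real \<Rightarrow> real set" where
  "mcomp G F x = mimage G (F x)"

primrec mpow :: "(real \<Rightarrow> real set) \<Rightarrow> nat \<Rightarrow> real \<Rightarrow> real set" where
  "mpow F 0 = (\<lambda>x. {x})"
| "mpow F (Suc n) = mcomp F (mpow F n)"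

definition usc_at :: "real \<Rightarrow> real \<Rightarrow> (real \<Rightarrow> real set) \<Rightarrow> real \<Rightarrow> bool" where
  "usc_at a b F x0 \<longleftrightarrow>
     (\<forall>V. open V \<longrightarrow> F x0 \<subseteq> V \<longrightarrow>
        (\<exists>U. open U \<and> x0 \<in> U \<and> (\<forall>x\<in>U \<inter> {a..b}. F x \<subseteq> V)))"

definition usc :: "real \<Rightarrow> real \<Rightarrow> (real \<Rightarrow> real set) \<Rightarrow> bool" where
  "usc a b F \<longleftrightarrow> (\<forall>x0\<in>{a..b}. usc_at a b F x0)"

text \<open>
  The library's \<open>Max\<close> and \<open>Min\<close> are meaningful for finite sets only, while the values of a
  multifunction may be infinite.
\<close>

definition is_max :: "real set \<Rightarrow> real \<Rightarrow> bool" where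
  "is_max S M \<longleftrightarrow> M \<in> S \<and> (\<forall>s\<in>S. s \<le> M)"

definition is_min :: "real set \<Rightarrow> real \<Rightarrow> bool" where
  "is_min S m \<longleftrightarrow> m \<in> S \<and> (\<forall>s\<in>S. m \<le> s)"

text \<open>The inequalities between maxima and minima include the existence of both.\<close>

definition mstrict_incr :: "real \<Rightarrow> real \<Rightarrow> (real \<Rightarrow> real set) \<Rightarrow> bool" where
  "mstrict_incr a b F \<longleftrightarrow>
     (\<forall>x\<in>{a..b}. \<forall>y\<in>{a..b}. x < y \<longrightarrow>
        (\<exists>M m. is_max (F x) M \<and> is_min (F y) m \<and> M < m))"

definition mstrict_decr :: "real \<Rightarrow> real \<Rightarrow> (real \<Rightarrow> real set) \<Rightarrow> bool" where
  "mstrict_decr a b F \<longleftrightarrow>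
     (\<forall>x\<in>{a..b}. \<forall>y\<in>{a..b}. x < y \<longrightarrow>
        (\<exists>m M. is_min (F x) m \<and> is_max (F y) M \<and> m > M))"

definition FI :: "real \<Rightarrow> real \<Rightarrow> (real \<Rightarrow> real set) set" where
  "FI a b = {F. multifun a b F \<and> usc a b F \<and> (mstrict_incr a b F \<or> mstrict_decr a b F)}"

text \<open>The disjunct \<open>infinite (F x)\<close> is needed because \<open>card\<close> of an infinite set is \<open>0\<close>.\<close>

definition jumps :: "real \<Rightarrow> real \<Rightarrow> (real \<Rightarrow> real set) \<Rightarrow> real set" where
  "jumps a b F = {x\<in>{a..b}. infinite (F x) \<or> 2 \<le> card (F x)}"

text \<open>
  Only used for strictly monotone \<open>F\<close> with finitely many jumps; then all iterates have finitely
  many jumps (a point belongs to at most one value of \<open>F\<close>), so \<open>card\<close> is the true cardinality.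
\<close>

definition intensity :: "real \<Rightarrow> real \<Rightarrow> (real \<Rightarrow> real set) \<Rightarrow> enat" where
  "intensity a b F =
     (if \<exists>k. card (jumps a b (mpow F k)) = card (jumps a b (mpow F (Suc k)))
      then enat (LEAST k. card (jumps a b (mpow F k)) = card (jumps a b (mpow F (Suc k))))
      else \<infinity>)"

definition FI1 :: "real \<Rightarrow> real \<Rightarrow> (real \<Rightarrow> real set) set" where
  "FI1 a b = {F \<in> FI a b. finite (jumps a b F) \<and> intensity a b F = 1}"

text \<open>
  The open intervals between consecutive points of \<open>J(F) \<union> {a, b}\<close>. For
  \<open>J(F) = {c\<^sub>1 < \<dots> < c\<^sub>m}\<close> inside \<open>(a, b)\<close> these are exactly the intervals \<open>(c\<^sub>i, c\<^sub>i\<^sub>+\<^sub>1)\<close>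
  with \<open>c\<^sub>0 = a\<close> and \<open>c\<^sub>m\<^sub>+\<^sub>1 = b\<close>; a jump at \<open>a\<close> or \<open>b\<close> does not change the set of intervals.
\<close>

definition jump_intervals :: "real \<Rightarrow> real \<Rightarrow> (real \<Rightarrow> real set) \<Rightarrow> real set set" where
  "jump_intervals a b F =
     {{c<..<d} | c d. c \<in> jumps a b F \<union> {a, b} \<and> d \<in> jumps a b F \<union> {a, b} \<and> c < d \<and>
        {c<..<d} \<inter> (jumps a b F \<union> {a, b}) = {}}"

definition Lambda :: "real \<Rightarrow> real \<Rightarrow> (real \<Rightarrow> real set) \<Rightarrow> real set set" where
  "Lambda a b G = {K \<in> jump_intervals a b G. mimage G K \<subseteq> K}"

end

theory Submission
  imports Defs
begin

text \<open>
  A strictly monotone multifunction has disjoint values, so a singleton value of an iterate forces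
  all earlier iterates to be singletons; together with intensity one this gives
  \<open>J(F\<^sup>2) = J(F)\<close>. An interior point at which \<open>f\<^sup>k\<close> is single-valued is not a jump of \<open>F\<close>, since
  there \<open>f\<^sup>k\<close> is continuous and agrees with \<open>F\<close> nearby. Hence for \<open>K \<in> \<Lambda>(F\<^sup>2)\<close> the interval \<open>f(K)\<close>
  avoids \<open>J(F)\<close> and lies in a single interval \<open>K'\<close>. As \<open>F\<^sup>2\<close> commutes with \<open>f\<close> on \<open>K\<close>, the
  interval \<open>F\<^sup>2(K')\<close> meets \<open>K'\<close>; it avoids \<open>J(F) \<union> {a, b}\<close>, so it is contained in \<open>K'\<close>.
\<close>

section \<open>Iterates and strict monotonicity\<close>

lemma mpow_one: "mpow F 1 = F"
  by (rule ext) (simp add: mcomp_def mimage_def)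

lemma mpow_two: "mpow F 2 x = mimage F (F x)"
  by (simp add: numeral_2_eq_2 mcomp_def mimage_def)

lemma mpow_Suc_singleton: "mpow f m x = {y} \<Longrightarrow> mpow f (Suc m) x = f y"
  by (simp add: mcomp_def mimage_def)

lemma mpow_add: "mpow F (m + n) x = mimage (mpow F m) (mpow F n x)"
  by (induction m) (auto simp: mcomp_def mimage_def)

lemma multifun_value:
  assumes "multifun a b F" "x \<in> {a..b}"
  shows "F x \<subseteq> {a..b}" "F x \<noteq> {}"
  using assms by (simp_all add: multifun_def)

lemma mpow_subset_nonempty:
  assumes "multifun a b F" "x \<in> {a..b}"
  shows "mpow F n x \<subseteq> {a..b} \<and> mpow F n x \<noteq> {}"
proof (induction n)
  case 0
  then show ?case using assms by auto
next
  case (Suc n)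
  then obtain y where y: "y \<in> mpow F n x" "y \<in> {a..b}" by blast
  have "F y \<noteq> {}" using y assms(1) by (simp add: multifun_value)
  then have "mpow F (Suc n) x \<noteq> {}" using y by (auto simp: mcomp_def mimage_def)
  moreover have "mpow F (Suc n) x \<subseteq> {a..b}"
    using Suc multifun_value(1)[OF assms(1)] unfolding mpow.simps mcomp_def mimage_def by blast
  ultimately show ?case by blast
qed

lemma mstrict_decr_less:
  assumes "mstrict_decr a b F" "x \<in> {a..b}" "y \<in> {a..b}" "x < y" "u \<in> F x" "v \<in> F y"
  shows "v < u"
proof -
  from assms(1-4) obtain m M where "is_min (F x) m" "is_max (F y) M" "m > M"
    unfolding mstrict_decr_def by blast
  with assms(5,6) show ?thesis by (force simp: is_min_def is_max_def)
qed

lemma mstrict_decr_disjoint: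
  assumes "mstrict_decr a b F" "x \<in> {a..b}" "y \<in> {a..b}" "u \<in> F x" "u \<in> F y"
  shows "x = y"
  using mstrict_decr_less[OF assms(1)] assms by (meson less_irrefl linorder_neqE_linordered_idom)

text \<open>Each \<open>F w\<close> with \<open>w\<close> in \<open>S\<close> is a nonempty subset
  of \<open>{y}\<close>, hence equal to it, and disjointness of the values leaves room for only one
  such \<open>w\<close>.\<close>

lemma mimage_eq_singletonE:
  assumes "multifun a b F" "mstrict_decr a b F" "S \<subseteq> {a..b}" "mimage F S = {y}"
  obtains z where "S = {z}" "F z = {y}"
proof -
  from assms(4) obtain z where z: "z \<in> S" by (auto simp: mimage_def)
  have val: "F w = {y}" if "w \<in> S" for w
  proof -
    have "F w \<noteq> {}" "F w \<subseteq> {y}"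
      using that assms by (auto simp: multifun_def mimage_def)
    then show ?thesis by blast
  qed
  have "w = z" if "w \<in> S" for w
    using mstrict_decr_disjoint[OF assms(2), of w z y] val that z assms(3) by blast
  then have "S = {z}" using z by blast
  with val z that show thesis by blast
qed

text \<open>Removing the outermost \<open>f\<close> from a singleton iterate leaves a singleton. The
  induction runs on \<open>n\<close> upwards from \<open>m\<close>, with \<open>y\<close> arbitrary
  because each removal changes the value.\<close>

lemma mpow_singleton_prefix:
  assumes "multifun a b f" "mstrict_decr a b f" "x \<in> {a..b}" "mpow f n x = {y}" "m \<le> n"
  shows "\<exists>z. mpow f m x = {z}"
  using assms(5,4)
proof (induction arbitrary: y rule: dec_induct)
  case base
  then show ?case by blast
next
  case (step i)
  have "mimage f (mpow f i x) = {y}" using step.prems by (simp add: mcomp_def)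
  then obtain z where "mpow f i x = {z}"
    using mimage_eq_singletonE[OF assms(1,2)] mpow_subset_nonempty[OF assms(1,3)] by metis
  then show ?case by (rule step.IH)
qed

text \<open>The values at \<open>a\<close> and \<open>b\<close> lie in \<open>{a..b}\<close>, and
  \<open>y\<close> lies strictly between them.\<close>

lemma mstrict_decr_interior:
  assumes "multifun a b F" "mstrict_decr a b F" "x \<in> {a<..<b}" "y \<in> F x"
  shows "y \<in> {a<..<b}"
proof -
  have x: "x \<in> {a..b}" "a \<in> {a..b}" "b \<in> {a..b}" "a < x" "x < b" using assms(3) by auto
  obtain u v where uv: "u \<in> F a" "v \<in> F b"
    using multifun_value(2)[OF assms(1) x(2)] multifun_value(2)[OF assms(1) x(3)] by auto
  have "u \<in> {a..b}" "v \<in> {a..b}"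
    using multifun_value(1)[OF assms(1) x(2)] multifun_value(1)[OF assms(1) x(3)] uv by auto
  moreover have "y < u"
    by (rule mstrict_decr_less[OF assms(2) x(2,1,4) uv(1) assms(4)])
  moreover have "v < y"
    by (rule mstrict_decr_less[OF assms(2) x(1,3,5) assms(4) uv(2)])
  ultimately show ?thesis by auto
qed

section \<open>Jumps, upper semi-continuity and intensity\<close>

lemma not_jump_iff:
  assumes "multifun a b F" "x \<in> {a..b}"
  shows "x \<notin> jumps a b F \<longleftrightarrow> (\<exists>y. F x = {y})"
proof
  assume *: "x \<notin> jumps a b F"
  have "F x \<noteq> {}" using assms by (auto simp: multifun_def)
  with * assms(2) have "card (F x) = 1"
    by (auto simp: jumps_def card_0_eq not_le less_Suc_eq numeral_2_eq_2)
  then show "\<exists>y. F x = {y}" by (auto simp: card_Suc_eq)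
next
  assume "\<exists>y. F x = {y}"
  then show "x \<notin> jumps a b F" by (auto simp: jumps_def)
qed

lemma usc_at_mpow:
  assumes "multifun a b F" "usc a b F" "x \<in> {a..b}"
  shows "usc_at a b (mpow F n) x"
proof (induction n)
  case 0
  then show ?case by (force simp: usc_at_def)
next
  case (Suc n)
  show ?case unfolding usc_at_def
  proof (intro allI impI)
    fix V assume V: "open V" "mpow F (Suc n) x \<subseteq> V"
    \<comment> \<open>\<open>W\<close> collects all open sets on which \<open>F\<close> stays inside
      \<open>V\<close>. Being a single open set that contains the whole value
      \<open>mpow F n x\<close>, it can be fed to the induction hypothesis without any compactness
      argument.\<close>
    define W where "W = \<Union>{U. open U \<and> (\<forall>y\<in>U \<inter> {a..b}. F y \<subseteq> V)}"
    have "mpow F n x \<subseteq> W"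
    proof
      fix y assume y: "y \<in> mpow F n x"
      then have "y \<in> {a..b}" using mpow_subset_nonempty[OF assms(1,3)] by blast
      moreover have "F y \<subseteq> V" using y V(2) by (auto simp: mcomp_def mimage_def)
      ultimately have "\<exists>U. open U \<and> y \<in> U \<and> (\<forall>z\<in>U \<inter> {a..b}. F z \<subseteq> V)"
        using assms(2) V(1) by (simp add: usc_def usc_at_def)
      then show "y \<in> W" unfolding W_def by blast
    qed
    moreover have "open W" unfolding W_def by (rule open_Union) blast
    ultimately obtain U where U: "open U" "x \<in> U" "\<forall>y\<in>U \<inter> {a..b}. mpow F n y \<subseteq> W"
      using Suc unfolding usc_at_def by meson
    have "mpow F (Suc n) y \<subseteq> V" if "y \<in> U \<inter> {a..b}" for y
    proof
      fix v assume "v \<in> mpow F (Suc n) y"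
      then obtain z where z: "z \<in> mpow F n y" "v \<in> F z" by (auto simp: mcomp_def mimage_def)
      then have "z \<in> {a..b}" using that mpow_subset_nonempty[OF assms(1), of y n] by blast
      moreover have "z \<in> W" using z U(3) that by blast
      ultimately show "v \<in> V" using z(2) unfolding W_def by blast
    qed
    with U show "\<exists>U. open U \<and> x \<in> U \<and> (\<forall>y\<in>U \<inter> {a..b}. mpow F (Suc n) y \<subseteq> V)" by blast
  qed
qed

text \<open>For singleton values upper semi-continuity is ordinary continuity. This makes images of
  jump-free intervals connected.\<close>

lemma usc_singleton_continuous_on:
  assumes "A \<subseteq> {a..b}" "\<And>x. x \<in> A \<Longrightarrow> usc_at a b F x" "\<And>x. x \<in> A \<Longrightarrow> F x = {g x}"
  shows "continuous_on A g"
  unfolding continuous_on_topological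
proof (intro ballI allI impI)
  fix x B assume x: "x \<in> A" "open B" "g x \<in> B"
  then have "F x \<subseteq> B" using assms(3) by simp
  with assms(2)[OF x(1)] x(2) obtain U
    where U: "open U" "x \<in> U" "\<forall>y\<in>U \<inter> {a..b}. F y \<subseteq> B"
    unfolding usc_at_def by blast
  have "g y \<in> B" if "y \<in> A" "y \<in> U" for y
    using U(3) that assms(1) assms(3)[OF that(1)] by blast
  with U show "\<exists>U. open U \<and> x \<in> U \<and> (\<forall>y\<in>A. y \<in> U \<longrightarrow> g y \<in> B)" by blast
qed

text \<open>
  The restriction to interior points is essential: at an endpoint only one one-sided limit
  constrains \<open>F\<close>.
\<close>

lemma not_jump_if_usc_agrees:
  assumes F: "multifun a b F" "mstrict_decr a b F" "finite (jumps a b F)"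
    and G: "usc_at a b G c" "\<And>x. x \<in> {a..b} - jumps a b F \<Longrightarrow> G x = F x"
    and c: "c \<in> {a<..<b}" "G c = {y}"
  shows "c \<notin> jumps a b F"
proof -
  have near: "\<exists>l r. l \<in> {a..b} \<and> r \<in> {a..b} \<and> l < c \<and> c < r \<and>
      F l \<subseteq> {y - e<..<y + e} \<and> F r \<subseteq> {y - e<..<y + e}" if e: "e > 0" for e
  proof -
    let ?V = "{y - e<..<y + e}"
    have "open ?V" "G c \<subseteq> ?V" using e c(2) by auto
    then obtain U where U: "open U" "c \<in> U" "\<forall>x\<in>U \<inter> {a..b}. G x \<subseteq> ?V"
      using G(1) unfolding usc_at_def by blast
    \<comment> \<open>Removing the finitely many other jumps keeps the set open; \<open>c\<close>
      itself stays in, since it might still be a jump. At the remaining points \<open>F\<close>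
      agrees with \<open>G\<close>.\<close>
    let ?T = "U \<inter> {a<..<b} - (jumps a b F - {c})"
    have "open ?T" "c \<in> ?T"
      using U c F(3) by (auto intro!: open_Diff finite_imp_closed)
    then obtain d where d: "d > 0" "\<And>x. \<bar>x - c\<bar> < d \<Longrightarrow> x \<in> ?T"
      unfolding open_dist dist_real_def by blast
    have T: "F x \<subseteq> ?V" "x \<in> {a..b}" if "x \<in> ?T" "x \<noteq> c" for x
    proof -
      have x: "x \<in> {a..b} - jumps a b F" "x \<in> U \<inter> {a..b}" using that by auto
      then show "F x \<subseteq> ?V" using G(2)[OF x(1)] U(3) by metis
      show "x \<in> {a..b}" using x by blast
    qed
    have l: "c - d/2 \<in> ?T" and r: "c + d/2 \<in> ?T" by (rule d(2); use d(1) in simp)+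
    show ?thesis
      using T[OF l] T[OF r] d(1) by (intro exI[of _ "c - d/2"] exI[of _ "c + d/2"]) auto
  qed
  have cI: "c \<in> {a..b}" using c by auto
  have "z = y" if z: "z \<in> F c" for z
  proof (rule ccontr)
    assume "z \<noteq> y"
    then have "\<bar>z - y\<bar> > 0" by simp
    from near[OF this] obtain l r where lr: "l \<in> {a..b}" "r \<in> {a..b}" "l < c" "c < r"
      "F l \<subseteq> {y - \<bar>z - y\<bar><..<y + \<bar>z - y\<bar>}" "F r \<subseteq> {y - \<bar>z - y\<bar><..<y + \<bar>z - y\<bar>}"
      by blast
    obtain u v where uv: "u \<in> F l" "v \<in> F r"
      using F(1) lr(1,2) unfolding multifun_def by blast
    \<comment> \<open>Monotonicity puts \<open>z\<close> strictly between \<open>v\<close> and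
      \<open>u\<close>. The radius \<open>\<bar>z - y\<bar>\<close> contradicts this: it forces
      \<open>u\<close> below \<open>z\<close> if \<open>z > y\<close>, and \<open>v\<close> above
      \<open>z\<close> if \<open>z < y\<close>.\<close>
    have "z < u" "v < z"
      using mstrict_decr_less[OF F(2) lr(1) cI lr(3) uv(1) z]
        mstrict_decr_less[OF F(2) cI lr(2) lr(4) z uv(2)] by auto
    moreover have "u < y + \<bar>z - y\<bar>" "y - \<bar>z - y\<bar> < v" using lr(5,6) uv by auto
    ultimately show False by linarith
  qed
  moreover have "F c \<noteq> {}" using F(1) cI by (auto simp: multifun_def)
  ultimately have "F c = {y}" by blast
  then show ?thesis using not_jump_iff[OF F(1) cI] by blast
qed

text \<open>Intensity one only equates cardinalities. Since a singleton \<open>F (F x)\<close>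
  forces a singleton \<open>F x\<close>, the jumps of \<open>F\<close> are among those of its
  square, and for finite sets this inclusion becomes equality.\<close>

lemma jumps_mpow_two_eq:
  assumes "multifun a b F" "mstrict_decr a b F" "intensity a b F = 1"
  shows "jumps a b (mpow F 2) = jumps a b F"
proof -
  let ?P = "\<lambda>k. card (jumps a b (mpow F k)) = card (jumps a b (mpow F (Suc k)))"
  have ex: "\<exists>k. ?P k" and least: "(LEAST k. ?P k) = 1"
    using assms(3) by (auto simp: intensity_def one_enat_def split: if_splits)
  have "?P 1" using LeastI_ex[OF ex] unfolding least .
  then have card_eq: "card (jumps a b F) = card (jumps a b (mpow F 2))"
    unfolding mpow_one by (simp only: Suc_1)
  \<comment> \<open>Minimality at 1 excludes 0, and the identity has no jumps, so the cardinality is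
    positive. This yields finiteness because \<open>card\<close> of an infinite set is 0.\<close>
  have "\<not> ?P 0" using not_less_Least[of 0 ?P] least by simp
  moreover have "jumps a b (mpow F 0) = {}" by (auto simp: jumps_def)
  ultimately have "card (jumps a b F) > 0"
    unfolding One_nat_def[symmetric] mpow_one by simp
  then have fin: "finite (jumps a b (mpow F 2))"
    using card_eq by (intro card_ge_0_finite) simp
  have "x \<in> jumps a b (mpow F 2)" if x: "x \<in> jumps a b F" for x
  proof (rule ccontr)
    have xI: "x \<in> {a..b}" using x by (simp add: jumps_def)
    have F2: "multifun a b (mpow F 2)"
      using mpow_subset_nonempty[OF assms(1)] unfolding multifun_def by blast
    assume "x \<notin> jumps a b (mpow F 2)"
    then obtain y where "mimage F (F x) = {y}"
      using not_jump_iff[OF F2 xI] mpow_two by metis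
    moreover have "F x \<subseteq> {a..b}" using assms(1) xI by (auto simp: multifun_def)
    ultimately obtain z where "F x = {z}"
      using mimage_eq_singletonE[OF assms(1,2)] by metis
    with x not_jump_iff[OF assms(1) xI] show False by blast
  qed
  then show ?thesis using card_subset_eq[OF fin] card_eq by blast
qed

section \<open>Intervals between consecutive jumps\<close>

lemma connected_subset_greaterThanLessThan:
  fixes c d :: real
  assumes "connected S" "c \<notin> S" "d \<notin> S" "p \<in> S" "p \<in> {c<..<d}"
  shows "S \<subseteq> {c<..<d}"
proof
  fix x assume x: "x \<in> S"
  show "x \<in> {c<..<d}"
  proof (rule ccontr)
    assume "x \<notin> {c<..<d}"
    then consider "x \<le> c" | "d \<le> x" by force
    then show False
      using assms x connectedD_interval[OF assms(1)]
      by cases (meson greaterThanLessThan_iff less_imp_le)+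
  qed
qed

lemma ex_jump_interval:
  assumes "finite (jumps a b F)" "p \<in> {a<..<b} - jumps a b F"
  obtains c d where "c \<in> jumps a b F \<union> {a, b}" "d \<in> jumps a b F \<union> {a, b}" "p \<in> {c<..<d}"
    "{c<..<d} \<in> jump_intervals a b F"
proof -
  let ?P = "jumps a b F \<union> {a, b}"
  \<comment> \<open>The nearest points of \<open>?P\<close> on either side of \<open>p\<close>;
    including \<open>a\<close> and \<open>b\<close> ensures that both exist.\<close>
  define c where "c = Max {x \<in> ?P. x < p}"
  define d where "d = Min {x \<in> ?P. p < x}"
  have fin: "finite {x \<in> ?P. x < p}" "finite {x \<in> ?P. p < x}" using assms(1) by auto
  have ne: "a \<in> {x \<in> ?P. x < p}" "b \<in> {x \<in> ?P. p < x}" using assms(2) by auto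
  have c: "c \<in> {x \<in> ?P. x < p}" and d: "d \<in> {x \<in> ?P. p < x}"
    unfolding c_def d_def using Max_in[OF fin(1)] Min_in[OF fin(2)] ne by blast+
  have cm: "x \<le> c" if "x \<in> ?P" "x < p" for x
    unfolding c_def using fin that by (intro Max_ge) auto
  have dm: "d \<le> x" if "x \<in> ?P" "p < x" for x
    unfolding d_def using fin that by (intro Min_le) auto
  have "p \<notin> ?P" using assms(2) by auto
  have "x \<notin> {c<..<d}" if "x \<in> ?P" for x
    using cm[OF that] dm[OF that] that \<open>p \<notin> ?P\<close> by (cases x p rule: linorder_cases) auto
  then have "{c<..<d} \<inter> ?P = {}" by blast
  moreover have "c < d" using c d by simp
  ultimately have "{c<..<d} \<in> jump_intervals a b F"
    using c d unfolding jump_intervals_def by blast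
  with c d show thesis by (intro that[of c d]) auto
qed

section \<open>The root on the intervals of \<open>Lambda\<close>\<close>

theorem corollary5p1:
  fixes a b :: real and F f :: "real \<Rightarrow> real set" and k :: nat and D :: "real set"
  assumes "a < b"
    and "F \<in> FI1 a b" and "mstrict_decr a b F"
    and "k \<ge> 1" and "odd k"
    and "f \<in> FI a b" and "mstrict_decr a b f"
    and "\<forall>x\<in>{a..b} - jumps a b F. mpow f k x = F x"
    and "D = \<Union> (Lambda a b (mpow F 2))"
  shows "mimage f D \<subseteq> D \<and>
    (\<exists>g :: real \<Rightarrow> real. (\<forall>x\<in>D. f x = {g x}) \<and> g ` D \<subseteq> D \<and> strict_antimono_on D g \<and>
       (\<forall>x\<in>D. F x = {(g ^^ k) x}))"
proof -
  have F: "multifun a b F" "usc a b F" "finite (jumps a b F)" "intensity a b F = 1"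
    using assms(2) by (auto simp: FI1_def FI_def)
  have f: "multifun a b f" "usc a b f" using assms(6) by (auto simp: FI_def)
  note Fd = assms(3) and fd = assms(7) and root = assms(8)
  let ?J = "jumps a b F"
  have J2: "jumps a b (mpow F 2) = ?J" by (rule jumps_mpow_two_eq[OF F(1) Fd F(4)])
  have F2: "multifun a b (mpow F 2)"
    using mpow_subset_nonempty[OF F(1)] unfolding multifun_def by blast

  \<comment> \<open>The jump-free interior is invariant under \<open>F\<close>: if
    \<open>F x = {y}\<close>, then \<open>F y\<close> is the value of the square at
    \<open>x\<close>, a singleton because both maps have the same jumps.\<close>
  have F2_single: "\<exists>y z. F x = {y} \<and> F y = {z} \<and> y \<in> {a<..<b} - ?J \<and> z \<in> {a<..<b} - ?J
      \<and> mpow F 2 x = {z}" if x: "x \<in> {a<..<b} - ?J" for x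
  proof -
    have step: "\<exists>y. F x = {y} \<and> y \<in> {a<..<b} - ?J" if x: "x \<in> {a<..<b} - ?J" for x
    proof -
      have xI: "x \<in> {a..b}" using x by auto
      obtain y where y: "F x = {y}" using x not_jump_iff[OF F(1) xI] by blast
      have yI: "y \<in> {a<..<b}" using mstrict_decr_interior[OF F(1) Fd, of x y] x y by blast
      have "mpow F 2 x = F y" using y by (simp add: mpow_two mimage_def)
      moreover have "\<exists>z. mpow F 2 x = {z}" using x not_jump_iff[OF F2 xI] J2 by blast
      ultimately have "y \<notin> ?J" using not_jump_iff[OF F(1), of y] yI by auto
      with y yI show ?thesis by blast
    qed
    obtain y where y: "F x = {y}" "y \<in> {a<..<b} - ?J" using step[OF x] by blast
    obtain z where z: "F y = {z}" "z \<in> {a<..<b} - ?J" using step[OF y(2)] by blast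
    show ?thesis using y z by (auto simp: mpow_two mimage_def)
  qed
  \<comment> \<open>The root equation holds only off the jumps; invariance allows it to be used at
    \<open>x\<close> and again at its image \<open>y\<close>.\<close>
  have root2: "mpow f (2 * k) x = mpow F 2 x" if x: "x \<in> {a<..<b} - ?J" for x
  proof -
    obtain y z where yz: "F x = {y}" "F y = {z}" "y \<in> {a<..<b} - ?J" "mpow F 2 x = {z}"
      using F2_single[OF x] by blast
    have "mpow f k x = F x" "mpow f k y = F y" using root x yz(3) by auto
    then show ?thesis using yz by (simp add: mult_2 mpow_add mimage_def)
  qed
  have f_single: "\<exists>y. f x = {y} \<and> y \<in> {a<..<b} - ?J" if x: "x \<in> {a<..<b} - ?J" for x
  proof -
    have xI: "x \<in> {a..b}" using x by auto
    obtain w where w: "mpow f (2 * k) x = {w}" using F2_single[OF x] root2[OF x] by blast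
    have single: "\<exists>z. mpow f m x = {z}" if "m \<le> 2 * k" for m
      by (rule mpow_singleton_prefix[OF f(1) fd xI w that])
    obtain y where y: "f x = {y}" using single[of 1] assms(4) mpow_one by (metis le_add1 mult_2 le_trans)
    have yI: "y \<in> {a<..<b}" using mstrict_decr_interior[OF f(1) fd, of x y] x y by blast
    \<comment> \<open>As \<open>k + 1 \<le> 2 * k\<close>, the iterate of order \<open>k + 1\<close>
      is still single-valued at \<open>x\<close>. So \<open>mpow f k\<close> is single-valued at
      \<open>y\<close>, and its agreement with \<open>F\<close> off the jumps shows that
      \<open>y\<close> is not a jump.\<close>
    have "mpow f (k + 1) x = mpow f k y"
      using y unfolding mpow_add mpow_one by (simp add: mimage_def)
    then obtain z where z: "mpow f k y = {z}" using single[of "k + 1"] assms(4) by auto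
    have "usc_at a b (mpow f k) y" using usc_at_mpow[OF f] yI by auto
    from not_jump_if_usc_agrees[OF F(1) Fd F(3) this _ yI z] root
    have "y \<notin> ?J" by blast
    with y yI show ?thesis by blast
  qed
  \<comment> \<open>\<open>the_elem\<close> picks the value on the jump-free interior; elsewhere
    \<open>g\<close> is never evaluated.\<close>
  define g where "g x = the_elem (f x)" for x
  have g: "f x = {g x}" "g x \<in> {a<..<b} - ?J" if "x \<in> {a<..<b} - ?J" for x
    using f_single[OF that] unfolding g_def by (metis the_elem_eq)+

  have K_sub: "K \<subseteq> {a<..<b} - ?J" if "K \<in> jump_intervals a b (mpow F 2)" for K
  proof -
    obtain c d where cd: "K = {c<..<d}" "c \<in> ?J \<union> {a, b}" "d \<in> ?J \<union> {a, b}"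
      "{c<..<d} \<inter> (?J \<union> {a, b}) = {}"
      using \<open>K \<in> jump_intervals a b (mpow F 2)\<close> J2 unfolding jump_intervals_def by auto
    have "a \<le> c" "d \<le> b" using cd(2,3) assms(1) by (auto simp: jumps_def)
    then show ?thesis using cd by auto
  qed
  then have D_sub: "D \<subseteq> {a<..<b} - ?J" unfolding assms(9) Lambda_def by blast

  have g_in_D: "g x \<in> D" if xD: "x \<in> D" for x
  proof -
    obtain K where K: "K \<in> jump_intervals a b (mpow F 2)" "mimage (mpow F 2) K \<subseteq> K" "x \<in> K"
      using xD unfolding assms(9) Lambda_def by blast
    have Ks: "K \<subseteq> {a<..<b} - ?J" by (rule K_sub[OF K(1)])
    have Kconn: "connected K" using K(1) unfolding jump_intervals_def by auto
    have "continuous_on K g"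
    proof (rule usc_singleton_continuous_on[of _ a b f])
      show "K \<subseteq> {a..b}" using Ks by force
      show "usc_at a b f u" if "u \<in> K" for u
        using f(2) \<open>K \<subseteq> {a..b}\<close> that unfolding usc_def by blast
      show "f u = {g u}" if "u \<in> K" for u using g(1) Ks that by blast
    qed
    then have gK: "connected (g ` K)" using Kconn by (rule connected_continuous_image)
    have xs: "x \<in> {a<..<b} - ?J" using Ks K(3) by blast
    \<comment> \<open>The interval around \<open>g x\<close> is the candidate member of
      \<open>Lambda\<close>; it remains to show its invariance under the square of
      \<open>F\<close>.\<close>
    obtain c d where cd: "c \<in> ?J \<union> {a, b}" "d \<in> ?J \<union> {a, b}" "g x \<in> {c<..<d}"
      "{c<..<d} \<in> jump_intervals a b (mpow F 2)"
      using ex_jump_interval[of a b "mpow F 2" "g x"] F(3) g(2)[OF xs] unfolding J2 by metis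
    let ?L = "{c<..<d}"
    have gKL: "g ` K \<subseteq> ?L"
    proof (rule connected_subset_greaterThanLessThan[OF gK _ _ _ cd(3)])
      have "g ` K \<inter> (?J \<union> {a, b}) = {}" using Ks g(2) by fastforce
      then show "c \<notin> g ` K" "d \<notin> g ` K" using cd(1,2) by blast+
      show "g x \<in> g ` K" using K(3) by blast
    qed
    define h where "h x = the_elem (mpow F 2 x)" for x
    have h: "mpow F 2 u = {h u}" "h u \<in> {a<..<b} - ?J" if "u \<in> {a<..<b} - ?J" for u
      using F2_single[OF that] unfolding h_def by (metis the_elem_eq)+
    have Ls: "?L \<subseteq> {a<..<b} - ?J" by (rule K_sub[OF cd(4)])
    have "continuous_on ?L h"
    proof (rule usc_singleton_continuous_on[of _ a b "mpow F 2"])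
      show "?L \<subseteq> {a..b}" using Ls by force
      show "usc_at a b (mpow F 2) u" if "u \<in> ?L" for u
        using usc_at_mpow[OF F(1,2)] \<open>?L \<subseteq> {a..b}\<close> that by blast
      show "mpow F 2 u = {h u}" if "u \<in> ?L" for u using h Ls that by blast
    qed
    then have hL: "connected (h ` ?L)" by (rule connected_continuous_image) simp
    \<comment> \<open>Splitting \<open>2 * k + 1\<close> applications of \<open>f\<close> in two
      ways gives \<open>h (g x) = g (h x)\<close>. Since \<open>h x\<close> stays in
      \<open>K\<close>, this point lies in the image of \<open>K\<close> under
      \<open>g\<close>.\<close>
    have "h (g x) \<in> ?L"
    proof -
      have "{h (g x)} = mpow f (2 * k) (g x)" using root2 h g(2)[OF xs] by blast
      also have "\<dots> = mpow f (2 * k + 1) x"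
        using g(1)[OF xs] unfolding mpow_add mpow_one by (simp add: mimage_def)
      also have "\<dots> = f (h x)"
        using mpow_Suc_singleton[of f "2 * k" x "h x"] root2[OF xs] h(1)[OF xs] by simp
      finally have "h (g x) \<in> f (h x)" by blast
      moreover have "h x \<in> K" using K(2,3) h(1)[OF xs] by (auto simp: mimage_def)
      ultimately have "h (g x) \<in> g ` K" using g(1) Ks by blast
      then show ?thesis using gKL by blast
    qed
    \<comment> \<open>One point of the image in \<open>?L\<close> suffices: the image is connected
      and, consisting of interior non-jumps, misses \<open>c\<close> and \<open>d\<close>.\<close>
    have "h ` ?L \<subseteq> ?L"
    proof (rule connected_subset_greaterThanLessThan[OF hL _ _ _ \<open>h (g x) \<in> ?L\<close>])
      have "h ` ?L \<inter> (?J \<union> {a, b}) = {}" using Ls h(2) by fastforce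
      then show "c \<notin> h ` ?L" "d \<notin> h ` ?L" using cd(1,2) by blast+
      show "h (g x) \<in> h ` ?L" using cd(3) by blast
    qed
    moreover have "mimage (mpow F 2) ?L = h ` ?L"
      using h(1) Ls unfolding mimage_def by blast
    ultimately have "?L \<in> Lambda a b (mpow F 2)" using cd(4) by (simp add: Lambda_def)
    then show ?thesis using cd(3) unfolding assms(9) by blast
  qed
  have gD: "f x = {g x}" if "x \<in> D" for x using that D_sub g(1) by blast
  \<comment> \<open>Invariance of \<open>D\<close> is carried along so that \<open>f\<close> is
    single-valued at every iterate.\<close>
  have iter: "mpow f n x = {(g ^^ n) x} \<and> (g ^^ n) x \<in> D" if "x \<in> D" for x n
    by (induction n) (use that gD g_in_D in \<open>auto simp: mcomp_def mimage_def\<close>)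
  have "F x = {(g ^^ k) x}" if "x \<in> D" for x
  proof -
    have "x \<in> {a..b} - ?J" using that D_sub by auto
    then show ?thesis using root iter[OF that] by metis
  qed
  moreover have "strict_antimono_on D g"
  proof (rule monotone_onI)
    fix x y assume xy: "x \<in> D" "y \<in> D" "x < y"
    then have "x \<in> {a..b}" "y \<in> {a..b}" using D_sub by auto
    then show "g x > g y"
      using mstrict_decr_less[OF fd, of x y] xy gD by blast
  qed
  moreover have "mimage f D \<subseteq> D" using gD g_in_D by (auto simp: mimage_def)
  ultimately show ?thesis using gD g_in_D by blast
qed

end
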